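(* Let $\alpha_0$ be a norm on $V$. The following are equivalent. (1) There is a $G$-invariant norm in $\mathscr N_{\alpha_0}(V)$. (2) The orbit $G\alpha_0$ is bounded in $\mathscr N_{\alpha_0}(V)$, i.e. $\sup_{g\in G}d_\infty(\alpha_0,g\alpha_0)<\infty$. (3) The orbit of some norm in $\mathscr N_{\alpha_0}(V)$ is bounded, i.e. there is $\beta\in\mathscr N_{\alpha_0}(V)$ with $\sup_{g\in G}d_\infty(\beta,g\beta)<\infty$. If these conditions hold, then $$\alpha_G(v)=\sup_{g\in G}\alpha_0(g^{-1}v)\qquad(v\in V)$$ is a $G$-invariant norm in $\mathscr N_{\alpha_0}(V)$.
   Context: Let $F$ and $E$ be finite extensions of $\mathbb Q_p$, with a fixed (non-Archimedean, nontrivial) absolute value $|\cdot|$ on $E$. Let $\mathbb G$ be a reductive group over $F$ and $G=\mathbb G(F)$. Let $\pi_{\mathrm{sm}}$ be a smooth admissible $E$-representation of $G$, let $\sigma_{\mathrm{alg}}$ be a finite-dimensional algebraic $E$-representation of $\operatorname{Res}_{F/\mathbb Q_p}\mathbb G$ (viewed as a representation of $G$), and put $V=\pi_{\mathrm{sm}}\otimes_E\sigma_{\mathrm{alg}}$ with the diagonal $G$-action. A norm on $V$ is a function $\alpha:V\to\mathbb R_{\ge0}$ with $\alpha(\lambda v)=|\lambda|\alpha(v)$, $\alpha(v+w)\le\max\{\alpha(v),\alpha(w)\}$ for $\lambda\in E$, $v,w\in V$, and $\alpha(v)=0\Rightarrow v=0$. For norms $\alpha,\beta$ put $d_\infty(\alpha,\beta)=\sup_{v\in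 V\setminus\{0\}}\left|\log\frac{\alpha(v)}{\beta(v)}\right|\in[0,+\infty]$ (an extended metric). The finite-distance component of $\alpha_0$ is $\mathscr N_{\alpha_0}(V)=\{\alpha:\ d_\infty(\alpha,\alpha_0)<\infty\}$. The group $G$ acts on norms by $(g\alpha)(v)=\alpha(g^{-1}v)$; a norm is $G$-invariant if $g\alpha=\alpha$ for all $g\in G$. *)

theory Defs
  imports "HOL-Analysis.Analysis" "HOL-Algebra.Algebraic_Closure_Type" "HOL-Algebra.Coset"
    "HOL-Library.Poly_Mapping"
begin

section \<open>Absolute values, \<open>p\<close>-adic fields and finite extensions\<close>

definition nonarch_abs :: "('k::field \<Rightarrow> real) \<Rightarrow> bool" where
  "nonarch_abs a \<longleftrightarrow>
     (\<forall>x. 0 \<le> a x) \<and> (\<forall>x. a x = 0 \<longleftrightarrow> x = 0) \<and>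
     (\<forall>x y. a (x * y) = a x * a y) \<and> (\<forall>x y. a (x + y) \<le> max (a x) (a y))"

definition nontrivial_abs :: "('k::field \<Rightarrow> real) \<Rightarrow> bool" where
  "nontrivial_abs a \<longleftrightarrow> (\<exists>x. x \<noteq> 0 \<and> a x \<noteq> 1)"

definition padic_abs_rat :: "nat \<Rightarrow> rat \<Rightarrow> real" where
  "padic_abs_rat p r =
     (if r = 0 then 0
      else real p powi (int (multiplicity (int p) (snd (quotient_of r)))
                      - int (multiplicity (int p) (fst (quotient_of r)))))"

text \<open>
  There is no type of \<open>p\<close>-adic numbers in the libraries.  As usual, \<open>\<rat>\<^sub>p\<close> is
  the completion of \<open>\<rat>\<close> for the \<open>p\<close>-adic absolute value: a complete valued field containing
  \<open>\<rat>\<close>, with its \<open>p\<close>-adic absolute value, as a dense subfield.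
\<close>
definition is_Qp :: "nat \<Rightarrow> ('q::field_char_0 \<Rightarrow> real) \<Rightarrow> bool" where
  "is_Qp p a \<longleftrightarrow>
     Factorial_Ring.prime p \<and> nonarch_abs a \<and>
     (\<forall>r. a (of_rat r) = padic_abs_rat p r) \<and>
     (\<forall>x. \<forall>\<epsilon>>0. \<exists>r. a (x - of_rat r) < \<epsilon>) \<and>
     Metric_space.mcomplete UNIV (\<lambda>x y. a (x - y))"

definition field_hom :: "('k::field \<Rightarrow> 'l::field) \<Rightarrow> bool" where
  "field_hom \<phi> \<longleftrightarrow> \<phi> 1 = 1 \<and>
     (\<forall>x y. \<phi> (x + y) = \<phi> x + \<phi> y) \<and> (\<forall>x y. \<phi> (x * y) = \<phi> x * \<phi> y)"

definition finite_extension :: "('k::field \<Rightarrow> 'l::field) \<Rightarrow> bool" where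
  "finite_extension \<phi> \<longleftrightarrow> field_hom \<phi> \<and>
     (\<exists>B. finite B \<and> Modules.module.span (\<lambda>c x. \<phi> c * x) B = UNIV)"

definition extension_basis :: "('k::field \<Rightarrow> 'l::field) \<Rightarrow> ('d::finite \<Rightarrow> 'l) \<Rightarrow> bool" where
  "extension_basis \<phi> e \<longleftrightarrow> (\<forall>y. \<exists>!c. y = (\<Sum>k\<in>UNIV. \<phi> (c k) * e k))"


section \<open>Linear algebraic groups\<close>

text \<open>
  Polynomials in variables from \<open>'x\<close> are finitely supported functions from monomials
  to coefficients; \<open>poly_eval \<phi> P\<close> applies \<open>\<phi>\<close> to the coefficients before evaluating.
\<close>
type_synonym ('x, 'k) mpolynomial = "('x \<Rightarrow>\<^sub>0 nat) \<Rightarrow>\<^sub>0 'k"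

definition poly_eval ::
    "('k::field \<Rightarrow> 'l::field) \<Rightarrow> ('x, 'k) mpolynomial \<Rightarrow> ('x \<Rightarrow> 'l) \<Rightarrow> 'l" where
  "poly_eval \<phi> P x =
     (\<Sum>m\<in>Poly_Mapping.keys P. \<phi> (Poly_Mapping.lookup P m) *
        (\<Prod>v\<in>Poly_Mapping.keys m. x v ^ Poly_Mapping.lookup m v))"

definition GL :: "('k::field^'n^'n) monoid" where
  "GL = \<lparr>carrier = {A. invertible A}, mult = (**), one = mat 1\<rparr>"

text \<open>
  An affine group over \<open>F\<close> is given by a set \<open>S\<close> of polynomials over \<open>F\<close> in the matrix
  entries, cutting it out of the general linear group.  For a field homomorphism \<open>\<phi>\<close> from
  \<open>F\<close> to \<open>L\<close>, \<open>alg_points \<phi> S\<close> is the set of \<open>L\<close>-points of the base change along \<open>\<phi>\<close>.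
\<close>
definition alg_points ::
    "('k::field \<Rightarrow> 'l::field) \<Rightarrow> ('n::finite \<times> 'n, 'k) mpolynomial set \<Rightarrow> ('l^'n^'n) set" where
  "alg_points \<phi> S =
     {g. invertible g \<and> (\<forall>P\<in>S. poly_eval \<phi> P (\<lambda>(i, j). g $ i $ j) = 0)}"

abbreviation rational_points ::
    "('n::finite \<times> 'n, 'k::field) mpolynomial set \<Rightarrow> ('k^'n^'n) set" where
  "rational_points \<equiv> alg_points (\<lambda>x. x)"

abbreviation geometric_points ::
    "('n::finite \<times> 'n, 'k::field) mpolynomial set \<Rightarrow> ('k alg_closure^'n^'n) set" where
  "geometric_points \<equiv> alg_points to_ac"

text \<open>
  The classical notion, with geometric points.  It is used over fields of characteristic zero
  only, where algebraic groups are smooth and hence determined by their geometric points, and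
  where every Zariski closed set defined by equations over \<open>F\<close> is defined over \<open>F\<close>.
\<close>
definition linear_algebraic_group :: "('n::finite \<times> 'n, 'k::field) mpolynomial set \<Rightarrow> bool" where
  "linear_algebraic_group S \<longleftrightarrow> subgroup (geometric_points S) GL"

definition zariski_closed :: "('k::field^'n::finite^'n) set \<Rightarrow> bool" where
  "zariski_closed N \<longleftrightarrow> (\<exists>T. N = rational_points T)"

definition zariski_connected :: "('k::field^'n::finite^'n) set \<Rightarrow> bool" where
  "zariski_connected N \<longleftrightarrow>
     \<not> (\<exists>A B. zariski_closed A \<and> zariski_closed B \<and> N \<subseteq> A \<union> B \<and>
           N \<inter> A \<noteq> {} \<and> N \<inter> B \<noteq> {} \<and> N \<inter> A \<inter> B = {})"

definition unipotent :: "('k::field^'n::finite^'n) \<Rightarrow> bool" where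
  "unipotent g \<longleftrightarrow> (\<exists>k. (((**) (g - mat 1)) ^^ k) (mat 1) = 0)"

text \<open>
  Reductive means trivial unipotent radical over the algebraic closure; connectedness is not
  part of the definition.
\<close>
definition reductive :: "('n::finite \<times> 'n, 'k::field) mpolynomial set \<Rightarrow> bool" where
  "reductive S \<longleftrightarrow> linear_algebraic_group S \<and>
     (\<forall>N. normal N (GL\<lparr>carrier := geometric_points S\<rparr>) \<and> zariski_closed N \<and>
          zariski_connected N \<and> (\<forall>g\<in>N. unipotent g) \<longrightarrow> N = {mat 1})"


section \<open>Smooth admissible representations\<close>

definition rep_of ::
    "('k::field^'n::finite^'n) set \<Rightarrow> ('e::field \<Rightarrow> 'v::ab_group_add \<Rightarrow> 'v) \<Rightarrow>
     ('k^'n^'n \<Rightarrow> 'v \<Rightarrow> 'v) \<Rightarrow> bool" where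
  "rep_of G s \<pi> \<longleftrightarrow> vector_space s \<and> (\<forall>g\<in>G. Vector_Spaces.linear s s (\<pi> g)) \<and>
     \<pi> (mat 1) = id \<and> (\<forall>g\<in>G. \<forall>h\<in>G. \<pi> (g ** h) = \<pi> g \<circ> \<pi> h)"

definition matrix_topology :: "('k::field \<Rightarrow> real) \<Rightarrow> ('k^'n::finite^'n) topology" where
  "matrix_topology a =
     Metric_space.mtopology UNIV (\<lambda>g h. Max (range (\<lambda>(i, j). a (g $ i $ j - h $ i $ j))))"

abbreviation group_topology ::
    "('k::field \<Rightarrow> real) \<Rightarrow> ('k^'n::finite^'n) set \<Rightarrow> ('k^'n^'n) topology" where
  "group_topology a G \<equiv> subtopology (matrix_topology a) G"

definition smooth_rep ::
    "('k::field \<Rightarrow> real) \<Rightarrow> ('k^'n::finite^'n) set \<Rightarrow> ('k^'n^'n \<Rightarrow> 'v \<Rightarrow> 'v) \<Rightarrow> bool" where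
  "smooth_rep a G \<pi> \<longleftrightarrow> (\<forall>v. openin (group_topology a G) {g\<in>G. \<pi> g v = v})"

definition admissible_rep ::
    "('k::field \<Rightarrow> real) \<Rightarrow> ('k^'n::finite^'n) set \<Rightarrow>
     ('e::field \<Rightarrow> 'v::ab_group_add \<Rightarrow> 'v) \<Rightarrow> ('k^'n^'n \<Rightarrow> 'v \<Rightarrow> 'v) \<Rightarrow> bool" where
  "admissible_rep a G s \<pi> \<longleftrightarrow>
     (\<forall>K. subgroup K (GL\<lparr>carrier := G\<rparr>) \<and> openin (group_topology a G) K \<and>
          compactin (group_topology a G) K \<longrightarrow>
        (\<exists>B. finite B \<and> {v. \<forall>g\<in>K. \<pi> g v = v} = Modules.module.span s B))"


section \<open>Weil restriction and its algebraic representations\<close>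

text \<open>
  Let \<open>\<iota>\<close> and \<open>\<kappa>\<close> embed \<open>\<rat>\<^sub>p\<close> into \<open>F\<close> and \<open>E\<close>, let \<open>e\<close> be a \<open>\<rat>\<^sub>p\<close>-basis of \<open>F\<close>,
  and let \<open>\<Omega>\<close> be the algebraic closure of \<open>E\<close>.  An \<open>\<Omega>\<close>-point of the restriction of scalars of
  \<open>S\<close> is a point of \<open>S\<close> with values in \<open>\<Omega> \<otimes> F\<close> (over \<open>\<rat>\<^sub>p\<close>).  A matrix over this algebra is
  written in coordinates as \<open>x i j k\<close>, the coefficient of \<open>e k\<close> in the entry at \<open>(i, j)\<close>.
  As \<open>F\<close> is separable over \<open>\<rat>\<^sub>p\<close>, \<open>\<Omega> \<otimes> F\<close> is the product of copies of \<open>\<Omega>\<close> indexed by the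
  \<open>\<rat>\<^sub>p\<close>-embeddings \<open>\<tau>\<close> of \<open>F\<close> into \<open>\<Omega>\<close>, and \<open>weil_component e x \<tau>\<close> is the image of \<open>x\<close> under
  the projection to the factor \<open>\<tau>\<close>.
\<close>
definition embeddings ::
    "('q::field \<Rightarrow> 'f::field) \<Rightarrow> ('q \<Rightarrow> 'e::field) \<Rightarrow> ('f \<Rightarrow> 'e alg_closure) set" where
  "embeddings \<iota> \<kappa> = {\<tau>. field_hom \<tau> \<and> (\<forall>c. \<tau> (\<iota> c) = to_ac (\<kappa> c))}"

definition weil_component ::
    "('d::finite \<Rightarrow> 'f::field) \<Rightarrow> 'l::field^'d^'n^'n \<Rightarrow> ('f \<Rightarrow> 'l) \<Rightarrow> 'l^'n::finite^'n" where
  "weil_component e x \<tau> = (\<chi> i j. \<Sum>k\<in>UNIV. x $ i $ j $ k * \<tau> (e k))"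

definition weil_points ::
    "('q::field \<Rightarrow> 'f::field) \<Rightarrow> ('q \<Rightarrow> 'e::field) \<Rightarrow> ('d::finite \<Rightarrow> 'f) \<Rightarrow>
     ('n::finite \<times> 'n, 'f) mpolynomial set \<Rightarrow> ('e alg_closure^'d^'n^'n) set" where
  "weil_points \<iota> \<kappa> e S =
     {x. \<forall>\<tau>\<in>embeddings \<iota> \<kappa>. weil_component e x \<tau> \<in> alg_points \<tau> S}"

text \<open>
  Regular functions over \<open>E\<close>: polynomials over \<open>E\<close> in the coordinates \<open>x i j k\<close> and one
  further variable (\<open>None\<close>) standing for the inverse of the norm of the determinant of \<open>x\<close>.
\<close>
definition regular_eval ::
    "('q::field \<Rightarrow> 'f::field) \<Rightarrow> ('q \<Rightarrow> 'e::field) \<Rightarrow> ('d::finite \<Rightarrow> 'f) \<Rightarrow>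
     (('n::finite \<times> 'n \<times> 'd) option, 'e) mpolynomial \<Rightarrow> 'e alg_closure^'d^'n^'n \<Rightarrow>
     'e alg_closure" where
  "regular_eval \<iota> \<kappa> e R x =
     poly_eval to_ac R
       (\<lambda>v. case v of
              Some (i, j, k) \<Rightarrow> x $ i $ j $ k
            | None \<Rightarrow> inverse (\<Prod>\<tau>\<in>embeddings \<iota> \<kappa>. det (weil_component e x \<tau>)))"

text \<open>
  \<open>\<sigma>\<close> is the restriction to the \<open>F\<close>-points of \<open>S\<close>, i.e. the \<open>\<rat>\<^sub>p\<close>-points of the
  restriction of scalars, of a finite-dimensional algebraic representation over \<open>E\<close>: in a basis
  \<open>B\<close> there is a matrix \<open>R\<close> of regular functions over \<open>E\<close> that is multiplicative and unital
  on the \<open>\<Omega>\<close>-points and gives the matrix of \<open>\<sigma> g\<close> at the point with the \<open>\<rat>\<^sub>p\<close>-coordinates \<open>x\<close>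
  of \<open>g\<close>.  The notion does not depend on the choice of \<open>e\<close>.
\<close>
definition algebraic_rep ::
    "('q::field \<Rightarrow> 'f::field) \<Rightarrow> ('q \<Rightarrow> 'e::field) \<Rightarrow> ('d::finite \<Rightarrow> 'f) \<Rightarrow>
     ('n::finite \<times> 'n, 'f) mpolynomial set \<Rightarrow>
     ('e \<Rightarrow> 's::ab_group_add \<Rightarrow> 's) \<Rightarrow> ('f^'n^'n \<Rightarrow> 's \<Rightarrow> 's) \<Rightarrow> bool" where
  "algebraic_rep \<iota> \<kappa> e S s \<sigma> \<longleftrightarrow>
     rep_of (rational_points S) s \<sigma> \<and>
     (\<exists>B R. finite B \<and> \<not> Modules.module.dependent s B \<and> Modules.module.span s B = UNIV \<and>
        (\<forall>x\<in>weil_points \<iota> \<kappa> e S. \<forall>y\<in>weil_points \<iota> \<kappa> e S. \<forall>z\<in>weil_points \<iota> \<kappa> e S.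
           (\<forall>\<tau>\<in>embeddings \<iota> \<kappa>.
              weil_component e z \<tau> = weil_component e x \<tau> ** weil_component e y \<tau>) \<longrightarrow>
           (\<forall>a\<in>B. \<forall>b\<in>B. regular_eval \<iota> \<kappa> e (R a b) z =
              (\<Sum>c\<in>B. regular_eval \<iota> \<kappa> e (R a c) x * regular_eval \<iota> \<kappa> e (R c b) y))) \<and>
        (\<forall>x\<in>weil_points \<iota> \<kappa> e S. (\<forall>\<tau>\<in>embeddings \<iota> \<kappa>. weil_component e x \<tau> = mat 1) \<longrightarrow>
           (\<forall>a\<in>B. \<forall>b\<in>B. regular_eval \<iota> \<kappa> e (R a b) x = (if a = b then 1 else 0))) \<and>
        (\<forall>g\<in>rational_points S. \<forall>x :: 'q^'d^'n^'n.
           (\<forall>i j. g $ i $ j = (\<Sum>k\<in>UNIV. \<iota> (x $ i $ j $ k) * e k)) \<longrightarrow>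
           (\<forall>a\<in>B. \<forall>b\<in>B.
              to_ac (Modules.module.representation s B (\<sigma> g b) a) =
              regular_eval \<iota> \<kappa> e (R a b) (\<chi> i j k. to_ac (\<kappa> (x $ i $ j $ k))))))"


section \<open>Tensor products\<close>

definition free_scale :: "'e::field \<Rightarrow> ('x \<Rightarrow>\<^sub>0 'e) \<Rightarrow> ('x \<Rightarrow>\<^sub>0 'e)" where
  "free_scale c f = Poly_Mapping.map ((*) c) f"

definition tensor_relations ::
    "('e::field \<Rightarrow> 'a::ab_group_add \<Rightarrow> 'a) \<Rightarrow> ('e \<Rightarrow> 'b::ab_group_add \<Rightarrow> 'b) \<Rightarrow>
     (('a \<times> 'b) \<Rightarrow>\<^sub>0 'e) set" where
  "tensor_relations sa sb =
     (let \<delta> = (\<lambda>x y. Poly_Mapping.single (x, y) 1) in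
      {\<delta> (x + x') y - \<delta> x y - \<delta> x' y | x x' y. True} \<union>
      {\<delta> x (y + y') - \<delta> x y - \<delta> x y' | x y y'. True} \<union>
      {\<delta> (sa c x) y - free_scale c (\<delta> x y) | c x y. True} \<union>
      {\<delta> x (sb c y) - free_scale c (\<delta> x y) | c x y. True})"

definition free_lift ::
    "('e::field \<Rightarrow> 'v::ab_group_add \<Rightarrow> 'v) \<Rightarrow> ('x \<Rightarrow> 'v) \<Rightarrow> ('x \<Rightarrow>\<^sub>0 'e) \<Rightarrow> 'v" where
  "free_lift sv t f = (\<Sum>x\<in>Poly_Mapping.keys f. sv (Poly_Mapping.lookup f x) (t x))"

text \<open>
  \<open>V\<close> with the map \<open>t\<close> (\<open>t x y\<close> being the pure tensor of \<open>x\<close> and \<open>y\<close>) is the tensor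
  product of \<open>A\<close> and \<open>B\<close>: \<open>t\<close> identifies \<open>V\<close> with the free vector space on pairs modulo the
  bilinearity relations.
\<close>
definition is_tensor_product ::
    "('e::field \<Rightarrow> 'a::ab_group_add \<Rightarrow> 'a) \<Rightarrow> ('e \<Rightarrow> 'b::ab_group_add \<Rightarrow> 'b) \<Rightarrow>
     ('e \<Rightarrow> 'v::ab_group_add \<Rightarrow> 'v) \<Rightarrow> ('a \<Rightarrow> 'b \<Rightarrow> 'v) \<Rightarrow> bool" where
  "is_tensor_product sa sb sv t \<longleftrightarrow>
     vector_space sa \<and> vector_space sb \<and> vector_space sv \<and>
     surj (free_lift sv (\<lambda>(x, y). t x y)) \<and>
     {f. free_lift sv (\<lambda>(x, y). t x y) f = 0} =
       Modules.module.span free_scale (tensor_relations sa sb)"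

definition diagonal_action ::
    "'g set \<Rightarrow> ('e::field \<Rightarrow> 'v::ab_group_add \<Rightarrow> 'v) \<Rightarrow> ('a \<Rightarrow> 'b \<Rightarrow> 'v) \<Rightarrow>
     ('g \<Rightarrow> 'a \<Rightarrow> 'a) \<Rightarrow> ('g \<Rightarrow> 'b \<Rightarrow> 'b) \<Rightarrow> ('g \<Rightarrow> 'v \<Rightarrow> 'v) \<Rightarrow> bool" where
  "diagonal_action G sv t \<pi> \<sigma> \<rho> \<longleftrightarrow>
     (\<forall>g\<in>G. Vector_Spaces.linear sv sv (\<rho> g) \<and> (\<forall>x y. \<rho> g (t x y) = t (\<pi> g x) (\<sigma> g y)))"


section \<open>Norms\<close>

definition is_norm ::
    "('e::field \<Rightarrow> real) \<Rightarrow> ('e \<Rightarrow> 'v::ab_group_add \<Rightarrow> 'v) \<Rightarrow> ('v \<Rightarrow> real) \<Rightarrow> bool" where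
  "is_norm a s \<alpha> \<longleftrightarrow>
     (\<forall>v. 0 \<le> \<alpha> v) \<and> (\<forall>c v. \<alpha> (s c v) = a c * \<alpha> v) \<and>
     (\<forall>v w. \<alpha> (v + w) \<le> max (\<alpha> v) (\<alpha> w)) \<and> (\<forall>v. \<alpha> v = 0 \<longrightarrow> v = 0)"

definition norm_dist :: "('v::ab_group_add \<Rightarrow> real) \<Rightarrow> ('v \<Rightarrow> real) \<Rightarrow> ennreal" where
  "norm_dist \<alpha> \<beta> = (SUP v\<in>UNIV - {0}. ennreal \<bar>ln (\<alpha> v / \<beta> v)\<bar>)"

definition norm_component ::
    "('e::field \<Rightarrow> real) \<Rightarrow> ('e \<Rightarrow> 'v::ab_group_add \<Rightarrow> 'v) \<Rightarrow> ('v \<Rightarrow> real) \<Rightarrow> ('v \<Rightarrow> real) set" where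
  "norm_component a s \<alpha>\<^sub>0 = {\<alpha>. is_norm a s \<alpha> \<and> norm_dist \<alpha> \<alpha>\<^sub>0 < \<infinity>}"

definition norm_act ::
    "('k::field^'n::finite^'n \<Rightarrow> 'v \<Rightarrow> 'v) \<Rightarrow> 'k^'n^'n \<Rightarrow> ('v \<Rightarrow> real) \<Rightarrow> 'v \<Rightarrow> real" where
  "norm_act \<rho> g \<alpha> = (\<lambda>v. \<alpha> (\<rho> (matrix_inv g) v))"

definition invariant_norm ::
    "('k::field^'n::finite^'n) set \<Rightarrow> ('k^'n^'n \<Rightarrow> 'v \<Rightarrow> 'v) \<Rightarrow> ('v \<Rightarrow> real) \<Rightarrow> bool" where
  "invariant_norm G \<rho> \<alpha> \<longleftrightarrow> (\<forall>g\<in>G. norm_act \<rho> g \<alpha> = \<alpha>)"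

definition bounded_orbit ::
    "('k::field^'n::finite^'n) set \<Rightarrow> ('k^'n^'n \<Rightarrow> 'v::ab_group_add \<Rightarrow> 'v) \<Rightarrow> ('v \<Rightarrow> real) \<Rightarrow> bool" where
  "bounded_orbit G \<rho> \<alpha> \<longleftrightarrow> (SUP g\<in>G. norm_dist \<alpha> (norm_act \<rho> g \<alpha>)) < \<infinity>"

end

theory Submission
  imports Defs
begin

text \<open>
  The equivalence is a statement about an arbitrary group acting linearly on a normed space.  Two
  norms are at finite distance iff each is bounded by a constant multiple of the other
  (\<open>uniform_norm_dist_finite_iff\<close>), and since a group contains the inverses of its elements, the
  orbit of \<open>\<alpha>\<close> is bounded iff there is a single constant \<open>c\<close> with \<open>\<alpha> (\<rho> g v) \<le> c * \<alpha> v\<close> for all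
  \<open>g\<close> and \<open>v\<close> (\<open>bounded_orbit_iff\<close>).  In this form, boundedness visibly passes between norms that
  are comparable (\<open>bounded_orbit_transfer\<close>), and it holds with \<open>c = 1\<close> for an invariant norm.
  Conversely, if the orbit of \<open>\<alpha>\<close> is bounded, the supremum of \<open>\<alpha>\<close> along the orbits of \<open>G\<close> on the
  vector space lies between \<open>\<alpha>\<close> and \<open>c * \<alpha>\<close>, is invariant because the supremum is over a whole
  group orbit, and inherits the ultrametric inequality because suprema commute with maxima.

  What remains is to extract such a group action from the data.  The \<open>F\<close>-points of an algebraic
  group form a group because they are the matrices over \<open>F\<close> among the geometric points
  (\<open>subgroup_rational_points\<close>).  The diagonal action on the tensor product is prescribed on pure
  tensors only, but these generate, so that it is multiplicative because both factors are
  (\<open>rep_of_tensor_product\<close>).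
\<close>

section \<open>The group of rational points\<close>

lemma matrix_inv:
  assumes "invertible A"
  shows matrix_inv_right: "A ** matrix_inv A = mat 1"
    and matrix_inv_left: "matrix_inv A ** A = mat 1"
  using someI_ex[OF assms[unfolded invertible_def]] by (simp_all add: matrix_inv_def)

lemma matrix_inv_unique:
  assumes "invertible A" "B ** A = mat 1"
  shows "matrix_inv A = B"
proof -
  have "B = B ** (A ** matrix_inv A)"
    by (simp add: matrix_inv_right[OF assms(1)])
  also have "\<dots> = matrix_inv A"
    by (simp add: matrix_mul_assoc assms(2))
  finally show ?thesis ..
qed

lemma GL_simps:
  "carrier GL = {A :: 'k::field^'n^'n. invertible A}"
  "mult GL = ((**) :: 'k::field^'n^'n \<Rightarrow> _)"
  "one GL = (mat 1 :: 'k::field^'n^'n)"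
  by (simp_all add: GL_def)

lemma m_inv_GL:
  fixes A :: "'k::field^'n^'n"
  assumes "invertible A"
  shows "m_inv GL A = matrix_inv A"
  unfolding m_inv_def GL_simps
proof (rule the_equality)
  show "matrix_inv A \<in> {A. invertible A} \<and> A ** matrix_inv A = mat 1 \<and> matrix_inv A ** A = mat 1"
    using matrix_inv[OF assms] by (auto simp: invertible_def)
next
  fix B
  assume "B \<in> {A. invertible A} \<and> A ** B = mat 1 \<and> B ** A = mat 1"
  then show "B = matrix_inv A"
    using matrix_inv_unique[OF assms, of B] by simp
qed

lemma subgroup_GL_iff:
  fixes H :: "('k::field^'n^'n) set"
  shows "subgroup H GL \<longleftrightarrow>
    (\<forall>g\<in>H. invertible g) \<and> (\<forall>g\<in>H. \<forall>h\<in>H. g ** h \<in> H) \<and> mat 1 \<in> H \<and> (\<forall>g\<in>H. matrix_inv g \<in> H)"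
  unfolding subgroup_def GL_simps by (auto simp: m_inv_GL subset_iff)

lemma map_matrix_to_ac_mult:
  fixes A B :: "'k::field^'n^'n"
  shows "map_matrix to_ac (A ** B) = map_matrix to_ac A ** map_matrix to_ac B"
  by (simp add: vec_eq_iff map_matrix_def matrix_matrix_mult_def to_ac_sum)

lemma map_matrix_to_ac_one: "map_matrix to_ac (mat 1 :: 'k::field^'n^'n) = mat 1"
  by (simp add: vec_eq_iff map_matrix_def mat_def)

lemma invertible_map_matrix_to_ac:
  fixes A :: "'k::field^'n^'n"
  assumes "invertible A"
  shows "invertible (map_matrix to_ac A)"
    and "matrix_inv (map_matrix to_ac A) = map_matrix to_ac (matrix_inv A)"
proof -
  let ?A = "map_matrix to_ac A" and ?B = "map_matrix to_ac (matrix_inv A)"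
  have *: "?A ** ?B = mat 1" "?B ** ?A = mat 1"
    by (simp_all add: matrix_inv[OF assms] map_matrix_to_ac_one flip: map_matrix_to_ac_mult)
  then show inv: "invertible ?A"
    unfolding invertible_def by blast
  show "matrix_inv ?A = ?B"
    by (rule matrix_inv_unique[OF inv *(2)])
qed

lemma poly_eval_to_ac: "poly_eval to_ac P (\<lambda>v. to_ac (x v)) = to_ac (poly_eval (\<lambda>c. c) P x)"
  by (simp add: poly_eval_def to_ac_sum to_ac_prod)

text \<open>
  The equations have coefficients in the base field, so their values at \<open>g\<close> are unchanged by passing
  to the algebraic closure, which is an injective map.
\<close>
lemma rational_points_iff_geometric:
  fixes g :: "'k::field^'n::finite^'n"
  assumes "invertible g"
  shows "g \<in> rational_points S \<longleftrightarrow> map_matrix to_ac g \<in> geometric_points S"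
proof -
  have "(\<lambda>(i, j). map_matrix to_ac g $ i $ j) = (\<lambda>v. to_ac ((\<lambda>(i, j). g $ i $ j) v))"
    by (auto simp: map_matrix_def)
  then have "poly_eval to_ac P (\<lambda>(i, j). map_matrix to_ac g $ i $ j) =
      to_ac (poly_eval (\<lambda>c. c) P (\<lambda>(i, j). g $ i $ j))" for P
    by (simp only: poly_eval_to_ac)
  then show ?thesis
    by (simp only: alg_points_def mem_Collect_eq assms invertible_map_matrix_to_ac to_ac_eq_0_iff)
qed

lemma subgroup_rational_points:
  fixes S :: "('n::finite \<times> 'n, 'k::field) mpolynomial set"
  assumes "linear_algebraic_group S"
  shows "subgroup (rational_points S) GL"
proof -
  have H: "subgroup (geometric_points S) GL"
    using assms by (simp add: linear_algebraic_group_def)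
  have mem: "g \<in> rational_points S \<longleftrightarrow> invertible g \<and> map_matrix to_ac g \<in> geometric_points S"
    for g :: "'k^'n^'n"
  proof (cases "invertible g")
    case True
    then show ?thesis by (simp add: rational_points_iff_geometric)
  qed (simp add: alg_points_def)
  have inv_inv: "invertible (matrix_inv g)" if "invertible g" for g :: "'k^'n^'n"
    using matrix_inv[OF that] by (auto simp: invertible_def)
  have one: "invertible (mat 1 :: 'k^'n^'n)"
    by (auto simp: invertible_def)
  show ?thesis
    using H unfolding subgroup_GL_iff
    by (auto simp: mem inv_inv one invertible_mult
        map_matrix_to_ac_mult map_matrix_to_ac_one simp flip: invertible_map_matrix_to_ac(2))
qed

section \<open>The diagonal action on a tensor product\<close>

lemma linear_free_lift:
  assumes "Vector_Spaces.linear s s' f"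
  shows "f (free_lift s t F) = free_lift s' (\<lambda>x. f (t x)) F"
proof -
  interpret Vector_Spaces.linear s s' f by (fact assms)
  show ?thesis by (simp add: free_lift_def sum scale)
qed

text \<open>
  Surjectivity of the map from the free vector space on pairs means that pure tensors span the
  tensor product.
\<close>
lemma linear_eq_on_pure_tensors:
  assumes "is_tensor_product sa sb sv t"
    and "Vector_Spaces.linear sv sw f" "Vector_Spaces.linear sv sw h"
    and "\<And>x y. f (t x y) = h (t x y)"
  shows "f = h"
proof
  fix v
  have "surj (free_lift sv (\<lambda>(x, y). t x y))"
    using assms(1) by (simp add: is_tensor_product_def)
  then obtain F where "v = free_lift sv (\<lambda>(x, y). t x y) F"
    by (rule surjE)
  moreover have "(\<lambda>z. f ((\<lambda>(x, y). t x y) z)) = (\<lambda>z. h ((\<lambda>(x, y). t x y) z))"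
    using assms(4) by auto
  ultimately show "f v = h v"
    by (simp only: linear_free_lift[OF assms(2)] linear_free_lift[OF assms(3)])
qed

lemma rep_of_tensor_product:
  assumes "subgroup G GL" "rep_of G sa \<pi>" "rep_of G sb \<sigma>"
    and "is_tensor_product sa sb sv t" "diagonal_action G sv t \<pi> \<sigma> \<rho>"
  shows "rep_of G sv \<rho>"
proof -
  have vs: "vector_space sv"
    using assms(4) by (simp add: is_tensor_product_def)
  have lin: "Vector_Spaces.linear sv sv (\<rho> g)"
    and pure: "\<rho> g (t x y) = t (\<pi> g x) (\<sigma> g y)" if "g \<in> G" for g x y
    using assms(5) that by (auto simp: diagonal_action_def)
  have G: "mat 1 \<in> G" "\<And>g h. g \<in> G \<Longrightarrow> h \<in> G \<Longrightarrow> g ** h \<in> G"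
    using assms(1) by (auto simp: subgroup_GL_iff)
  have "\<rho> (mat 1) = id"
  proof (rule linear_eq_on_pure_tensors[OF assms(4) lin[OF G(1)]])
    show "Vector_Spaces.linear sv sv id"
      by (rule vector_space.linear_id[OF vs])
    show "\<rho> (mat 1) (t x y) = id (t x y)" for x y
      using assms(2,3) by (simp add: pure[OF G(1)] rep_of_def)
  qed
  moreover have "\<rho> (g ** h) = \<rho> g \<circ> \<rho> h" if "g \<in> G" "h \<in> G" for g h
  proof (rule linear_eq_on_pure_tensors[OF assms(4) lin[OF G(2)[OF that]]])
    show "Vector_Spaces.linear sv sv (\<rho> g \<circ> \<rho> h)"
      by (rule Vector_Spaces.linear_compose[OF lin[OF that(2)] lin[OF that(1)]])
    show "\<rho> (g ** h) (t x y) = (\<rho> g \<circ> \<rho> h) (t x y)" for x y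
      using assms(2,3) that by (simp add: pure G rep_of_def)
  qed
  ultimately show ?thesis
    using vs lin by (simp add: rep_of_def)
qed

section \<open>Norms at finite distance\<close>

lemma abs_ln_divide_le_ln_iff:
  fixes x y c :: real
  assumes "0 < x" "0 < y" "0 < c"
  shows "\<bar>ln (x / y)\<bar> \<le> ln c \<longleftrightarrow> x \<le> c * y \<and> y \<le> c * x"
proof -
  have "ln (x / y) \<le> ln c \<longleftrightarrow> x \<le> c * y"
    using assms by (simp add: field_simps)
  moreover have "- ln (x / y) = ln (y / x)"
    using assms by (simp add: ln_div)
  moreover have "ln (y / x) \<le> ln c \<longleftrightarrow> y \<le> c * x"
    using assms by (simp add: field_simps)
  ultimately show ?thesis
    by (simp add: abs_le_iff)
qed

text \<open>
  The family version serves both the distance of two norms and the diameter of an orbit, where the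
  point is that one constant works for all members.
\<close>
lemma uniform_norm_dist_finite_iff:
  fixes \<alpha> \<beta> :: "'i \<Rightarrow> 'v::ab_group_add \<Rightarrow> real"
  assumes "\<And>i v. i \<in> I \<Longrightarrow> v \<noteq> 0 \<Longrightarrow> 0 < \<alpha> i v" "\<And>i v. i \<in> I \<Longrightarrow> v \<noteq> 0 \<Longrightarrow> 0 < \<beta> i v"
    and "\<And>i. i \<in> I \<Longrightarrow> \<alpha> i 0 = 0" "\<And>i. i \<in> I \<Longrightarrow> \<beta> i 0 = 0"
  shows "(SUP i\<in>I. norm_dist (\<alpha> i) (\<beta> i)) < \<infinity> \<longleftrightarrow>
    (\<exists>c>0. \<forall>i\<in>I. \<forall>v. \<alpha> i v \<le> c * \<beta> i v \<and> \<beta> i v \<le> c * \<alpha> i v)"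
    (is "?D < \<infinity> \<longleftrightarrow> _")
proof
  assume "?D < \<infinity>"
  then obtain C where C: "0 \<le> C" "?D = ennreal C"
    by (cases ?D) auto
  have "\<alpha> i v \<le> exp C * \<beta> i v \<and> \<beta> i v \<le> exp C * \<alpha> i v" if "i \<in> I" for i v
  proof (cases "v = 0")
    case False
    have "ennreal \<bar>ln (\<alpha> i v / \<beta> i v)\<bar> \<le> norm_dist (\<alpha> i) (\<beta> i)"
      using False unfolding norm_dist_def by (intro SUP_upper) simp
    also have "\<dots> \<le> ?D"
      using that by (rule SUP_upper)
    finally have "\<bar>ln (\<alpha> i v / \<beta> i v)\<bar> \<le> ln (exp C)"
      using C by simp
    then show ?thesis
      using False that assms(1,2) by (subst (asm) abs_ln_divide_le_ln_iff) auto
  qed (use that assms(3,4) in simp)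
  then show "\<exists>c>0. \<forall>i\<in>I. \<forall>v. \<alpha> i v \<le> c * \<beta> i v \<and> \<beta> i v \<le> c * \<alpha> i v"
    by (meson exp_gt_zero)
next
  assume "\<exists>c>0. \<forall>i\<in>I. \<forall>v. \<alpha> i v \<le> c * \<beta> i v \<and> \<beta> i v \<le> c * \<alpha> i v"
  then obtain c where c: "c > 0" "\<And>i v. i \<in> I \<Longrightarrow> \<alpha> i v \<le> c * \<beta> i v \<and> \<beta> i v \<le> c * \<alpha> i v"
    by blast
  have "?D \<le> ennreal (ln c)"
    unfolding norm_dist_def
  proof (intro SUP_least ennreal_leI)
    fix i and v :: 'v
    assume "i \<in> I" "v \<in> UNIV - {0}"
    then show "\<bar>ln (\<alpha> i v / \<beta> i v)\<bar> \<le> ln c"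
      using c assms(1,2) by (subst abs_ln_divide_le_ln_iff) auto
  qed
  then show "?D < \<infinity>"
    using ennreal_less_top order_le_less_trans by fastforce
qed

section \<open>Linear actions with bounded orbits\<close>

locale valued_representation =
  fixes a :: "'e::field \<Rightarrow> real" and s :: "'e \<Rightarrow> 'v::ab_group_add \<Rightarrow> 'v"
    and G :: "('k::field^'n::finite^'n) set" and \<rho> :: "'k^'n^'n \<Rightarrow> 'v \<Rightarrow> 'v"
  assumes nonarch: "nonarch_abs a" and subgroup: "subgroup G GL" and rep: "rep_of G s \<rho>"
begin

sublocale vector_space s
  using rep by (simp add: rep_of_def)

lemma norm_zero:
  assumes "is_norm a s \<alpha>"
  shows "\<alpha> 0 = 0"
proof -
  have "\<alpha> (s 0 0) = a 0 * \<alpha> 0"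
    using assms by (simp only: is_norm_def)
  moreover have "a 0 = 0"
    using nonarch by (simp add: nonarch_abs_def)
  ultimately show ?thesis by simp
qed

lemma norm_pos:
  assumes "is_norm a s \<alpha>" "v \<noteq> 0"
  shows "0 < \<alpha> v"
  using assms unfolding is_norm_def by (metis less_eq_real_def)

lemma norm_component_iff:
  assumes "is_norm a s \<alpha>\<^sub>0"
  shows "\<alpha> \<in> norm_component a s \<alpha>\<^sub>0 \<longleftrightarrow>
    is_norm a s \<alpha> \<and> (\<exists>c>0. \<forall>v. \<alpha> v \<le> c * \<alpha>\<^sub>0 v \<and> \<alpha>\<^sub>0 v \<le> c * \<alpha> v)"
proof (cases "is_norm a s \<alpha>")
  case True
  then show ?thesis
    using uniform_norm_dist_finite_iff[of "{()}" "\<lambda>_. \<alpha>" "\<lambda>_. \<alpha>\<^sub>0"] assms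
    by (simp add: norm_component_def norm_pos norm_zero)
qed (simp add: norm_component_def)

lemma one_mem: "mat 1 \<in> G"
  and mult_mem: "g \<in> G \<Longrightarrow> h \<in> G \<Longrightarrow> g ** h \<in> G"
  and inv_mem: "g \<in> G \<Longrightarrow> matrix_inv g \<in> G"
  using subgroup by (auto simp: subgroup_GL_iff)

lemma act_mult: "g \<in> G \<Longrightarrow> h \<in> G \<Longrightarrow> \<rho> (g ** h) v = \<rho> g (\<rho> h v)"
  and act_one: "\<rho> (mat 1) v = v"
  using rep by (auto simp: rep_of_def)

lemma act_inv:
  assumes "g \<in> G"
  shows "\<rho> g (\<rho> (matrix_inv g) v) = v" "\<rho> (matrix_inv g) (\<rho> g v) = v"
proof -
  have "invertible g"
    using assms subgroup by (simp add: subgroup_GL_iff)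
  then show "\<rho> g (\<rho> (matrix_inv g) v) = v" "\<rho> (matrix_inv g) (\<rho> g v) = v"
    by (simp_all add: assms inv_mem act_one matrix_inv flip: act_mult)
qed

lemma linear_act: "g \<in> G \<Longrightarrow> Vector_Spaces.linear s s (\<rho> g)"
  using rep by (simp add: rep_of_def)

lemma
  assumes "g \<in> G"
  shows act_scale: "\<rho> g (s c v) = s c (\<rho> g v)"
    and act_add: "\<rho> g (v + w) = \<rho> g v + \<rho> g w"
    and act_zero: "\<rho> g 0 = 0"
proof -
  interpret act: Vector_Spaces.linear s s "\<rho> g" using assms by (rule linear_act)
  show "\<rho> g (s c v) = s c (\<rho> g v)" "\<rho> g (v + w) = \<rho> g v + \<rho> g w" "\<rho> g 0 = 0"
    by (rule act.scale act.add act.zero)+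
qed

lemma act_eq_zero_iff: "g \<in> G \<Longrightarrow> \<rho> g v = 0 \<longleftrightarrow> v = 0"
  by (metis act_inv(2) act_zero inv_mem)

text \<open>
  The reverse inequality, which boundedness of the distances also demands, comes from the inverse
  group element.
\<close>
lemma bounded_orbit_iff:
  assumes "is_norm a s \<alpha>"
  shows "bounded_orbit G \<rho> \<alpha> \<longleftrightarrow> (\<exists>c>0. \<forall>g\<in>G. \<forall>v. \<alpha> (\<rho> g v) \<le> c * \<alpha> v)"
proof -
  have "bounded_orbit G \<rho> \<alpha> \<longleftrightarrow>
    (\<exists>c>0. \<forall>g\<in>G. \<forall>v. \<alpha> v \<le> c * norm_act \<rho> g \<alpha> v \<and> norm_act \<rho> g \<alpha> v \<le> c * \<alpha> v)"
    unfolding bounded_orbit_def using assms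
    by (intro uniform_norm_dist_finite_iff)
      (auto simp: norm_act_def norm_pos norm_zero inv_mem act_zero act_eq_zero_iff)
  also have "\<dots> \<longleftrightarrow> (\<exists>c>0. \<forall>g\<in>G. \<forall>v. \<alpha> (\<rho> g v) \<le> c * \<alpha> v)"
  proof (intro iff_exI conj_cong refl iffI ballI allI)
    fix c g v
    assume "\<forall>g\<in>G. \<forall>v. \<alpha> v \<le> c * norm_act \<rho> g \<alpha> v \<and> norm_act \<rho> g \<alpha> v \<le> c * \<alpha> v" "g \<in> G"
    then have "\<alpha> (\<rho> g v) \<le> c * norm_act \<rho> g \<alpha> (\<rho> g v)" by blast
    then show "\<alpha> (\<rho> g v) \<le> c * \<alpha> v"
      using \<open>g \<in> G\<close> by (simp add: norm_act_def act_inv)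
  next
    fix c g v
    assume *: "\<forall>g\<in>G. \<forall>v. \<alpha> (\<rho> g v) \<le> c * \<alpha> v" and g: "g \<in> G"
    have "\<alpha> (\<rho> g (\<rho> (matrix_inv g) v)) \<le> c * \<alpha> (\<rho> (matrix_inv g) v)"
      using * g by blast
    then show "\<alpha> v \<le> c * norm_act \<rho> g \<alpha> v \<and> norm_act \<rho> g \<alpha> v \<le> c * \<alpha> v"
      using * g by (simp add: norm_act_def act_inv inv_mem)
  qed
  finally show ?thesis .
qed

lemma bounded_orbit_transfer:
  assumes \<alpha>\<^sub>0: "is_norm a s \<alpha>\<^sub>0" and \<beta>: "\<beta> \<in> norm_component a s \<alpha>\<^sub>0"
    and bounded: "bounded_orbit G \<rho> \<beta>"
  shows "bounded_orbit G \<rho> \<alpha>\<^sub>0"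
proof -
  obtain c where c: "c > 0" "\<And>v. \<beta> v \<le> c * \<alpha>\<^sub>0 v" "\<And>v. \<alpha>\<^sub>0 v \<le> c * \<beta> v"
    using \<beta> norm_component_iff[OF \<alpha>\<^sub>0] by blast
  have "is_norm a s \<beta>"
    using \<beta> by (simp add: norm_component_def)
  then obtain d where d: "d > 0" "\<And>g v. g \<in> G \<Longrightarrow> \<beta> (\<rho> g v) \<le> d * \<beta> v"
    using bounded bounded_orbit_iff by blast
  have "\<alpha>\<^sub>0 (\<rho> g v) \<le> (c * d * c) * \<alpha>\<^sub>0 v" if "g \<in> G" for g v
  proof -
    have "\<alpha>\<^sub>0 (\<rho> g v) \<le> c * \<beta> (\<rho> g v)" by (rule c)
    also have "\<dots> \<le> c * (d * \<beta> v)"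
      using c(1) d(2)[OF that] by simp
    also have "\<dots> \<le> c * (d * (c * \<alpha>\<^sub>0 v))"
      using c(1,2) d(1) by simp
    finally show ?thesis by (simp add: mult_ac)
  qed
  moreover have "c * d * c > 0"
    using c d by simp
  ultimately show ?thesis
    using bounded_orbit_iff[OF \<alpha>\<^sub>0] by blast
qed

lemma invariant_imp_bounded_orbit:
  assumes "is_norm a s \<alpha>" "invariant_norm G \<rho> \<alpha>"
  shows "bounded_orbit G \<rho> \<alpha>"
proof -
  have "\<alpha> (\<rho> g v) = \<alpha> v" if "g \<in> G" for g v
    using assms(2) act_inv(2)[OF that] that unfolding invariant_norm_def norm_act_def by metis
  then show ?thesis
    unfolding bounded_orbit_iff[OF assms(1)] by (intro exI[of _ 1]) simp
qed

section \<open>The supremum over an orbit\<close>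

definition orbit_sup :: "('v \<Rightarrow> real) \<Rightarrow> 'v \<Rightarrow> real" where
  "orbit_sup \<alpha> v = (SUP g\<in>G. \<alpha> (\<rho> (matrix_inv g) v))"

context
  fixes \<alpha> assumes norm: "is_norm a s \<alpha>" and bounded: "bounded_orbit G \<rho> \<alpha>"
begin

lemma orbit_bdd_above: "bdd_above ((\<lambda>g. \<alpha> (\<rho> (matrix_inv g) v)) ` G)"
proof -
  obtain c where "\<And>g v. g \<in> G \<Longrightarrow> \<alpha> (\<rho> g v) \<le> c * \<alpha> v"
    using bounded bounded_orbit_iff[OF norm] by blast
  then show ?thesis
    by (intro bdd_aboveI2[of _ _ "c * \<alpha> v"]) (simp add: inv_mem)
qed

lemma orbit_sup_upper:
  assumes "g \<in> G"
  shows "\<alpha> (\<rho> g v) \<le> orbit_sup \<alpha> v"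
proof -
  \<comment> \<open>The supremum runs over inverses, so \<open>g\<close> enters as the inverse of its inverse.\<close>
  have "matrix_inv (matrix_inv g) = g"
  proof -
    have "invertible g" "invertible (matrix_inv g)"
      using assms inv_mem subgroup by (auto simp: subgroup_GL_iff)
    then show ?thesis
      by (simp add: matrix_inv_unique matrix_inv_right)
  qed
  moreover have "\<alpha> (\<rho> (matrix_inv (matrix_inv g)) v) \<le> orbit_sup \<alpha> v"
    unfolding orbit_sup_def using orbit_bdd_above inv_mem[OF assms] by (rule cSUP_upper2) simp
  ultimately show ?thesis by simp
qed

lemma orbit_sup_least:
  assumes "\<And>g. g \<in> G \<Longrightarrow> \<alpha> (\<rho> g v) \<le> b"
  shows "orbit_sup \<alpha> v \<le> b"
  unfolding orbit_sup_def using one_mem assms inv_mem by (intro cSUP_least) auto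

lemma norm_le_orbit_sup: "\<alpha> v \<le> orbit_sup \<alpha> v"
  using orbit_sup_upper[OF one_mem] by (simp add: act_one)

lemma orbit_sup_scale_le: "orbit_sup \<alpha> (s c v) \<le> a c * orbit_sup \<alpha> v"
proof (rule orbit_sup_least)
  fix g assume g: "g \<in> G"
  have "\<alpha> (\<rho> g (s c v)) = a c * \<alpha> (\<rho> g v)" "0 \<le> a c"
    using norm nonarch g by (simp_all add: act_scale is_norm_def nonarch_abs_def)
  then show "\<alpha> (\<rho> g (s c v)) \<le> a c * orbit_sup \<alpha> v"
    using orbit_sup_upper[OF g] by (simp add: mult_left_mono)
qed

lemma orbit_sup_nonneg: "0 \<le> orbit_sup \<alpha> v"
  using norm norm_le_orbit_sup[of v] unfolding is_norm_def by (meson order_trans)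

lemma is_norm_orbit_sup: "is_norm a s (orbit_sup \<alpha>)"
  unfolding is_norm_def
proof (intro conjI allI impI)
  fix c v w
  show "0 \<le> orbit_sup \<alpha> v" by (rule orbit_sup_nonneg)
  show "orbit_sup \<alpha> (s c v) = a c * orbit_sup \<alpha> v"
  proof (rule antisym[OF orbit_sup_scale_le])
    have a: "a 0 = 0" "\<And>x. 0 \<le> a x" "\<And>x. x \<noteq> 0 \<Longrightarrow> a x \<noteq> 0" "\<And>x y. a (x * y) = a x * a y"
      using nonarch by (auto simp: nonarch_abs_def)
    show "a c * orbit_sup \<alpha> v \<le> orbit_sup \<alpha> (s c v)"
    proof (cases "c = 0")
      case True
      then show ?thesis
        using orbit_sup_nonneg by (simp add: a)
    next
      case False
      \<comment> \<open>The inequality already known, for the inverse scalar.\<close>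
      have "a c * orbit_sup \<alpha> v = a c * orbit_sup \<alpha> (s (inverse c) (s c v))"
        using False by simp
      also have "\<dots> \<le> a c * (a (inverse c) * orbit_sup \<alpha> (s c v))"
        by (intro mult_left_mono orbit_sup_scale_le a)
      also have "\<dots> = a (c * inverse c) * orbit_sup \<alpha> (s c v)"
        by (simp add: a)
      also have "\<dots> = orbit_sup \<alpha> (s c v)"
        using False a(3)[of 1] a(4)[of 1 1] by simp
      finally show ?thesis .
    qed
  qed
  show "orbit_sup \<alpha> (v + w) \<le> max (orbit_sup \<alpha> v) (orbit_sup \<alpha> w)"
  proof (rule orbit_sup_least)
    fix g assume g: "g \<in> G"
    have "\<alpha> (\<rho> g (v + w)) \<le> max (\<alpha> (\<rho> g v)) (\<alpha> (\<rho> g w))"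
      using norm g by (simp add: act_add is_norm_def)
    also have "\<dots> \<le> max (orbit_sup \<alpha> v) (orbit_sup \<alpha> w)"
      using orbit_sup_upper[OF g] by (intro max.mono)
    finally show "\<alpha> (\<rho> g (v + w)) \<le> max (orbit_sup \<alpha> v) (orbit_sup \<alpha> w)" .
  qed
next
  fix v assume "orbit_sup \<alpha> v = 0"
  then show "v = 0"
    using norm_le_orbit_sup[of v] norm_pos[OF norm, of v] by force
qed

lemma orbit_sup_in_component: "orbit_sup \<alpha> \<in> norm_component a s \<alpha>"
proof -
  obtain c where c: "c > 0" "\<And>g v. g \<in> G \<Longrightarrow> \<alpha> (\<rho> g v) \<le> c * \<alpha> v"
    using bounded bounded_orbit_iff[OF norm] by blast
  have "orbit_sup \<alpha> v \<le> c * \<alpha> v" for v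
    by (rule orbit_sup_least) (rule c)
  moreover have "\<alpha> v \<le> c * orbit_sup \<alpha> v" for v
  proof -
    \<comment> \<open>The same constant serves in this direction, because the identity element
      forces \<open>c \<ge> 1\<close> unless the space is zero.\<close>
    have "\<alpha> v \<le> c * \<alpha> v"
      using c(2)[OF one_mem] by (simp add: act_one)
    also have "\<dots> \<le> c * orbit_sup \<alpha> v"
      using c(1) norm_le_orbit_sup by simp
    finally show ?thesis .
  qed
  ultimately show ?thesis
    using c(1) is_norm_orbit_sup norm_component_iff[OF norm] by blast
qed

text \<open>
  An inequality suffices for invariance: the values over the orbit of \<open>\<rho> h v\<close> are among those over
  the orbit of \<open>v\<close>, and the inverse of \<open>h\<close> leads back.
\<close>
lemma orbit_sup_act_le:
  assumes "h \<in> G"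
  shows "orbit_sup \<alpha> (\<rho> h v) \<le> orbit_sup \<alpha> v"
proof (rule orbit_sup_least)
  fix g assume "g \<in> G"
  then show "\<alpha> (\<rho> g (\<rho> h v)) \<le> orbit_sup \<alpha> v"
    using orbit_sup_upper[OF mult_mem] assms by (simp flip: act_mult)
qed

lemma invariant_orbit_sup: "invariant_norm G \<rho> (orbit_sup \<alpha>)"
  unfolding invariant_norm_def norm_act_def
proof (intro ballI ext antisym)
  fix g v assume g: "g \<in> G"
  show "orbit_sup \<alpha> (\<rho> (matrix_inv g) v) \<le> orbit_sup \<alpha> v"
    using g by (intro orbit_sup_act_le inv_mem)
  show "orbit_sup \<alpha> v \<le> orbit_sup \<alpha> (\<rho> (matrix_inv g) v)"
    using orbit_sup_act_le[OF g, of "\<rho> (matrix_inv g) v"] g by (simp add: act_inv)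
qed

end

end

section \<open>Invariant norms and bounded orbits\<close>

theorem theorem5p1:
  fixes p :: nat
    and absQ :: "'q::field_char_0 \<Rightarrow> real"
    and \<iota> :: "'q \<Rightarrow> 'f::field" and absF :: "'f \<Rightarrow> real" and e :: "'d::finite \<Rightarrow> 'f"
    and \<kappa> :: "'q \<Rightarrow> 'e::field" and absE :: "'e \<Rightarrow> real"
    and S :: "('n::finite \<times> 'n, 'f) mpolynomial set"
    and G :: "('f^'n^'n) set"
    and sP :: "'e \<Rightarrow> 'p::ab_group_add \<Rightarrow> 'p" and \<pi> :: "'f^'n^'n \<Rightarrow> 'p \<Rightarrow> 'p"
    and sS :: "'e \<Rightarrow> 's::ab_group_add \<Rightarrow> 's" and \<sigma> :: "'f^'n^'n \<Rightarrow> 's \<Rightarrow> 's"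
    and sV :: "'e \<Rightarrow> 'v::ab_group_add \<Rightarrow> 'v" and t :: "'p \<Rightarrow> 's \<Rightarrow> 'v"
    and \<rho> :: "'f^'n^'n \<Rightarrow> 'v \<Rightarrow> 'v"
    and \<alpha>\<^sub>0 :: "'v \<Rightarrow> real"
  assumes "is_Qp p absQ"
    and "finite_extension \<iota>" and "extension_basis \<iota> e"
    and "nonarch_abs absF" and "\<And>c. absF (\<iota> c) = absQ c"
    and "finite_extension \<kappa>"
    and "nonarch_abs absE" and "nontrivial_abs absE"
    and "reductive S" and "G = rational_points S"
    and "rep_of G sP \<pi>" and "smooth_rep absF G \<pi>" and "admissible_rep absF G sP \<pi>"
    and "algebraic_rep \<iota> \<kappa> e S sS \<sigma>"
    and "is_tensor_product sP sS sV t" and "diagonal_action G sV t \<pi> \<sigma> \<rho>"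
    and "is_norm absE sV \<alpha>\<^sub>0"
  shows "((\<exists>\<alpha>\<in>norm_component absE sV \<alpha>\<^sub>0. invariant_norm G \<rho> \<alpha>) \<longleftrightarrow> bounded_orbit G \<rho> \<alpha>\<^sub>0) \<and>
         (bounded_orbit G \<rho> \<alpha>\<^sub>0 \<longleftrightarrow> (\<exists>\<beta>\<in>norm_component absE sV \<alpha>\<^sub>0. bounded_orbit G \<rho> \<beta>)) \<and>
         (bounded_orbit G \<rho> \<alpha>\<^sub>0 \<longrightarrow>
            (\<forall>v. bdd_above ((\<lambda>g. \<alpha>\<^sub>0 (\<rho> (matrix_inv g) v)) ` G)) \<and>
            (\<lambda>v. SUP g\<in>G. \<alpha>\<^sub>0 (\<rho> (matrix_inv g) v)) \<in> norm_component absE sV \<alpha>\<^sub>0 \<and>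
            invariant_norm G \<rho> (\<lambda>v. SUP g\<in>G. \<alpha>\<^sub>0 (\<rho> (matrix_inv g) v)))"
proof -
  have subgroup: "subgroup G GL"
    using \<open>reductive S\<close> \<open>G = rational_points S\<close>
    by (simp add: reductive_def subgroup_rational_points)
  have "rep_of G sS \<sigma>"
    using \<open>algebraic_rep \<iota> \<kappa> e S sS \<sigma>\<close> \<open>G = rational_points S\<close> by (simp add: algebraic_rep_def)
  then have "rep_of G sV \<rho>"
    by (rule rep_of_tensor_product[OF subgroup \<open>rep_of G sP \<pi>\<close> _
          \<open>is_tensor_product sP sS sV t\<close> \<open>diagonal_action G sV t \<pi> \<sigma> \<rho>\<close>])
  then interpret valued_representation absE sV G \<rho>
    using \<open>nonarch_abs absE\<close> subgroup by (intro valued_representation.intro)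
  note norm = \<open>is_norm absE sV \<alpha>\<^sub>0\<close>
  have "\<alpha>\<^sub>0 \<in> norm_component absE sV \<alpha>\<^sub>0"
    unfolding norm_component_iff[OF norm] using norm by (auto intro: exI[of _ 1])
  moreover have "is_norm absE sV \<alpha>" if "\<alpha> \<in> norm_component absE sV \<alpha>\<^sub>0" for \<alpha>
    using that by (simp add: norm_component_def)
  moreover note bounded_orbit_transfer[OF norm] invariant_imp_bounded_orbit
    orbit_bdd_above[OF norm] orbit_sup_in_component[OF norm] invariant_orbit_sup[OF norm]
  moreover have "orbit_sup \<alpha>\<^sub>0 = (\<lambda>v. SUP g\<in>G. \<alpha>\<^sub>0 (\<rho> (matrix_inv g) v))"
    by (auto simp: orbit_sup_def)
  ultimately show ?thesis
    by metis
qed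

end
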